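(* For each $n>0$ and all proper $\alpha_1,\dots,\alpha_{n+1}\in2^\omega$ we have \[ s^{\oplus_n}_{\alpha_1,\dots,\alpha_n}\le_{sW} s^{\oplus_{n+1}}_{\alpha_1,\dots,\alpha_{n+1}} \quad\text{and}\quad s^{\oplus_{n+1}}_{\alpha_1,\dots,\alpha_{n+1}}\not\le_{W} s^{\oplus_n}_{\alpha_1,\dots,\alpha_n}. \]
   Context: Cantor space $2^\omega$ carries the lexicographic order $<_{lex}$. For $\alpha\in2^\omega$, $s_\alpha\colon 2^\omega\to\{0,1\}$ is $s_\alpha(x)=0$ if $x<_{lex}\alpha$ and $s_\alpha(x)=1$ if $x\ge_{lex}\alpha$. A sequence is proper if it contains infinitely many $1$'s. $\oplus_m$ denotes addition modulo $2$ of $m$ bits, and for $\alpha_1,\dots,\alpha_m\in2^\omega$, $s^{\oplus_m}_{\alpha_1,\dots,\alpha_m}\colon(2^\omega)^m\to\{0,1\}$ is $(x_1,\dots,x_m)\mapsto s_{\alpha_1}(x_1)\oplus\dots\oplus s_{\alpha_m}(x_m)$. $f\le_W g$ means there are computable functionals $\Phi,\Psi$ with $f(x)=\Psi(x,g(\Phi(x)))$ for all $x$ in the domain of $f$; $f\le_{sW} g$ means $f(x)=\Psi(g(\Phi(x)))$. *)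

theory Defs
  imports Main "HOL-Library.Fun_Lexorder"
begin

section \<open>Computable functionals\<close>

text \<open>
  Partial recursive functions relative to finitely many number-theoretic functions
  (Kleene): \<open>Query i\<close> asks for a value of the \<open>i\<close>-th function argument, and the remaining
  constructors are the usual schemes. \<open>PrimRec\<close> and \<open>Mu\<close> operate on the first number
  argument; the step function of \<open>PrimRec\<close> receives the counter, the previous value and
  the parameters, in this order.
\<close>

datatype recfn =
    Zero
  | Succ
  | Proj nat
  | Query nat
  | Comp recfn "recfn list"
  | PrimRec recfn recfn
  | Mu recfn

text \<open>
  \<open>computes fs c ns v\<close>: the computation of \<open>c\<close> with function arguments \<open>fs\<close> and number
  arguments \<open>ns\<close> halts with value \<open>v\<close>.
\<close>

inductive computes :: "(nat \<Rightarrow> nat) list \<Rightarrow> recfn \<Rightarrow> nat list \<Rightarrow> nat \<Rightarrow> bool"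
  for fs :: "(nat \<Rightarrow> nat) list" where
  Zero: "computes fs Zero ns 0"
| Succ: "computes fs Succ [n] (Suc n)"
| Proj: "i < length ns \<Longrightarrow> computes fs (Proj i) ns (ns ! i)"
| Query: "i < length fs \<Longrightarrow> computes fs (Query i) [n] ((fs ! i) n)"
| Comp: "list_all2 (\<lambda>d v. computes fs d ns v) ds vs \<Longrightarrow> computes fs c vs w
    \<Longrightarrow> computes fs (Comp c ds) ns w"
| PrimRec_0: "computes fs c ns v \<Longrightarrow> computes fs (PrimRec c d) (0 # ns) v"
| PrimRec_Suc: "computes fs (PrimRec c d) (n # ns) v \<Longrightarrow> computes fs d (n # v # ns) w
    \<Longrightarrow> computes fs (PrimRec c d) (Suc n # ns) w"
| Mu: "computes fs c (n # ns) 0 \<Longrightarrow> (\<forall>j<n. \<exists>v. computes fs c (j # ns) v \<and> v > 0)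
    \<Longrightarrow> computes fs (Mu c) ns n"

text \<open>
  A pair \<open>(fs, ns)\<close> with \<open>length fs = k\<close> and \<open>length ns = l\<close> is a point of the product of
  \<open>k\<close> copies of Baire space and \<open>l\<close> copies of the natural numbers. Thus \<open>m\<close>-tuples of
  elements of Cantor space are the points \<open>(xs, [])\<close> with \<open>length xs = m\<close>, and a bit \<open>b\<close>
  is the point \<open>([], [b])\<close>.
\<close>

type_synonym point = "(nat \<Rightarrow> nat) list \<times> nat list"

definition point_pair :: "point \<Rightarrow> point \<Rightarrow> point" where
  "point_pair x y = (fst x @ fst y, snd x @ snd y)"

text \<open>
  A partial functional is computable if some programs, one for each output component,
  compute it on its domain (outside the domain their behaviour is irrelevant). The domain
  lies in a single product space, given by \<open>k\<close> and \<open>l\<close>. Consequently, in the definition of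
  Weihrauch reducibility below, both \<open>x\<close> and \<open>w\<close> can be recovered from \<open>point_pair x w\<close>.
\<close>

definition computable_functional :: "(point \<rightharpoonup> point) \<Rightarrow> bool" where
  "computable_functional F \<longleftrightarrow>
    (\<exists>k l cs ds. \<forall>fs ns gs ms. F (fs, ns) = Some (gs, ms) \<longrightarrow>
       length fs = k \<and> length ns = l \<and>
       list_all2 (\<lambda>c g. \<forall>j. computes fs c (j # ns) (g j)) cs gs \<and>
       list_all2 (\<lambda>d m. computes fs d ns m) ds ms)"

definition weihrauch_le :: "(point \<rightharpoonup> point) \<Rightarrow> (point \<rightharpoonup> point) \<Rightarrow> bool"
    (infix "\<le>\<^sub>W" 50) where
  "f \<le>\<^sub>W g \<longleftrightarrow>
    (\<exists>\<Phi> \<Psi>. computable_functional \<Phi> \<and> computable_functional \<Psi> \<and>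
      (\<forall>x y. f x = Some y \<longrightarrow>
        (\<exists>z w. \<Phi> x = Some z \<and> g z = Some w \<and> \<Psi> (point_pair x w) = Some y)))"

definition strong_weihrauch_le :: "(point \<rightharpoonup> point) \<Rightarrow> (point \<rightharpoonup> point) \<Rightarrow> bool"
    (infix "\<le>\<^sub>s\<^sub>W" 50) where
  "f \<le>\<^sub>s\<^sub>W g \<longleftrightarrow>
    (\<exists>\<Phi> \<Psi>. computable_functional \<Phi> \<and> computable_functional \<Psi> \<and>
      (\<forall>x y. f x = Some y \<longrightarrow>
        (\<exists>z w. \<Phi> x = Some z \<and> g z = Some w \<and> \<Psi> w = Some y)))"

section \<open>Step functions on Cantor space\<close>

definition cantor :: "(nat \<Rightarrow> nat) set" where
  "cantor = {x. \<forall>k. x k \<in> {0, 1}}"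

definition proper :: "(nat \<Rightarrow> nat) \<Rightarrow> bool" where
  "proper x \<longleftrightarrow> infinite {k. x k = 1}"

text \<open>\<open>less_fun\<close> is the strict lexicographic order.\<close>

definition step :: "(nat \<Rightarrow> nat) \<Rightarrow> (nat \<Rightarrow> nat) \<Rightarrow> nat" where
  "step \<alpha> x = (if less_fun x \<alpha> then 0 else 1)"

definition step_xor :: "(nat \<Rightarrow> nat) list \<Rightarrow> (point \<rightharpoonup> point)" where
  "step_xor \<alpha>s = (\<lambda>(xs, ns).
    if length xs = length \<alpha>s \<and> set xs \<subseteq> cantor \<and> ns = []
    then Some ([], [(\<Sum>i<length \<alpha>s. step (\<alpha>s ! i) (xs ! i)) mod 2])
    else None)"

end

theory Submission
  imports Defs "HOL-Library.Infinite_Set"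
begin

text \<open>
  Iterated discontinuity (Hertling's level). Restrict the parity of the step functions of
  \<open>\<alpha>\<^sub>1, \<dots>, \<alpha>\<^sub>m\<close> to the tuples with at least \<open>k\<close> coordinates equal to the corresponding
  \<open>\<alpha>\<^sub>i\<close>. This restriction is discontinuous exactly at the tuples with at least \<open>k + 1\<close> such
  coordinates: properness lets one such coordinate be moved slightly below \<open>\<alpha>\<^sub>i\<close>, which flips
  the parity, while nearby an unequal coordinate stays unequal and on its side. By continuity and
  induction on \<open>k\<close>, a Weihrauch reduction maps tuples with at least \<open>k\<close> equal coordinates to
  tuples with at least \<open>k\<close> equal coordinates. For \<open>k = n + 1\<close> this is impossible if the target
  has only \<open>n\<close> coordinates.
\<close>

text \<open>For fixed \<open>fs\<close>, the sets of \<open>gs\<close> with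
  \<open>agree N fs gs\<close> are the basic neighbourhoods of \<open>fs\<close> in a finite product
  of copies of Baire space.\<close>

definition agree :: "nat \<Rightarrow> (nat \<Rightarrow> nat) list \<Rightarrow> (nat \<Rightarrow> nat) list \<Rightarrow> bool" where
  "agree N fs gs \<longleftrightarrow> list_all2 (\<lambda>f g. \<forall>k<N. f k = g k) fs gs"

lemma agree_mono: "agree N fs gs \<Longrightarrow> M \<le> N \<Longrightarrow> agree M fs gs"
  by (auto simp: agree_def list_all2_conv_all_nth)

lemma agree_list_update:
  "i < length fs \<Longrightarrow> (\<And>k. k < N \<Longrightarrow> (fs ! i) k = g k) \<Longrightarrow> agree N fs (fs[i := g])"
  unfolding agree_def list_all2_conv_all_nth by (auto simp: nth_list_update)

text \<open>Asking for all large \<open>M\<close>, not just one, lets finitely many thresholds be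
  merged by \<open>max\<close> without assuming that \<open>P\<close> is monotone in
  \<open>M\<close>.\<close>

lemma uniform_bound_nat:
  assumes "\<And>j. j < (n::nat) \<Longrightarrow> \<exists>N::nat. \<forall>M\<ge>N. P j M"
  shows "\<exists>N. \<forall>M\<ge>N. \<forall>j<n. P j M"
  using assms
proof (induction n)
  case 0
  then show ?case by simp
next
  case (Suc n)
  then obtain N1 where N1: "\<forall>M\<ge>N1. \<forall>j<n. P j M"
    by (metis less_SucI)
  from Suc.prems obtain N2 where N2: "\<forall>M\<ge>N2. P n M" by blast
  have "\<forall>M\<ge>max N1 N2. \<forall>j<Suc n. P j M"
    using N1 N2 by (auto simp: less_Suc_eq)
  then show ?case by blast
qed

subsection \<open>Computations are deterministic and have finite use\<close>

inductive_cases computes_ZeroE: "computes fs Zero ns v"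
inductive_cases computes_SuccE: "computes fs Succ ns v"
inductive_cases computes_ProjE: "computes fs (Proj i) ns v"
inductive_cases computes_QueryE: "computes fs (Query i) ns v"
inductive_cases computes_CompE: "computes fs (Comp c ds) ns v"
inductive_cases computes_PrimRec_0E: "computes fs (PrimRec c d) (0 # ns) v"
inductive_cases computes_PrimRec_SucE: "computes fs (PrimRec c d) (Suc n # ns) v"
inductive_cases computes_MuE: "computes fs (Mu c) ns v"

lemma computes_deterministic:
  "computes fs c ns v \<Longrightarrow> computes fs c ns w \<Longrightarrow> v = w"
proof (induction arbitrary: w rule: computes.induct)
  case (Zero ns)
  then show ?case by (auto elim: computes_ZeroE)
next
  case (Succ n)
  then show ?case by (auto elim: computes_SuccE)
next
  case (Proj i ns)
  then show ?case by (auto elim: computes_ProjE)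
next
  case (Query i n)
  then show ?case by (auto elim: computes_QueryE)
next
  case (Comp ns ds vs c u)
  from Comp.prems obtain vs' where
    vs': "list_all2 (\<lambda>d v. computes fs d ns v) ds vs'" "computes fs c vs' w"
    by (elim computes_CompE) auto
  have "vs = vs'"
    using Comp.IH(1) vs'(1) by (auto simp: list_all2_conv_all_nth intro: nth_equalityI)
  then show ?case using Comp.IH(2) vs'(2) by blast
next
  case (PrimRec_0 c ns v d)
  from PrimRec_0.prems have "computes fs c ns w" by (elim computes_PrimRec_0E)
  then show ?case by (rule PrimRec_0.IH)
next
  case (PrimRec_Suc c d n ns v u)
  from PrimRec_Suc.prems obtain v' where
    "computes fs (PrimRec c d) (n # ns) v'" "computes fs d (n # v' # ns) w"
    by (elim computes_PrimRec_SucE) auto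
  then show ?case using PrimRec_Suc.IH by blast
next
  case (Mu c n ns)
  from Mu.prems have w: "computes fs c (w # ns) 0"
      "\<forall>j<w. \<exists>v. computes fs c (j # ns) v \<and> v > 0"
    by (elim computes_MuE; simp)+
  \<comment> \<open>If the two results differed, the search body would have both value 0 and a
    positive value at the smaller one.\<close>
  show ?case
  proof (rule linorder_cases[of n w])
    assume "n < w"
    then show ?thesis using w(2) Mu.IH(1) by force
  next
    assume "w < n"
    then show ?thesis using w(1) Mu.IH(2) by force
  qed simp
qed

text \<open>A halting computation has a finite derivation, so it makes only finitely many oracle
  queries; \<open>N\<close> bounds all queried positions.\<close>

lemma computes_finite_use:
  "computes fs c ns v \<Longrightarrow> \<exists>N. \<forall>M\<ge>N. \<forall>gs. agree M fs gs \<longrightarrow> computes gs c ns v"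
proof (induction rule: computes.induct)
  case (Zero ns)
  then show ?case by (auto intro: computes.intros)
next
  case (Succ n)
  then show ?case by (auto intro: computes.intros)
next
  case (Proj i ns)
  then show ?case by (auto intro: computes.intros)
next
  case (Query i n)
  have "computes gs (recfn.Query i) [n] ((fs ! i) n)" if "agree M fs gs" "M \<ge> Suc n" for M gs
  proof -
    have "i < length gs" "(fs ! i) n = (gs ! i) n"
      using that Query by (auto simp: agree_def list_all2_conv_all_nth)
    then show ?thesis by (simp add: computes.Query)
  qed
  then show ?case by blast
next
  case (Comp ns ds vs c w)
  have len: "length ds = length vs" using Comp.IH(1) by (simp add: list_all2_conv_all_nth)
  have "\<exists>N. \<forall>M\<ge>N. \<forall>j<length ds. \<forall>gs. agree M fs gs \<longrightarrow> computes gs (ds ! j) ns (vs ! j)"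
    using Comp.IH(1) by (intro uniform_bound_nat) (auto simp: list_all2_conv_all_nth)
  then obtain N1 where N1: "\<And>M gs j. M \<ge> N1 \<Longrightarrow> j < length ds \<Longrightarrow> agree M fs gs \<Longrightarrow>
      computes gs (ds ! j) ns (vs ! j)" by blast
  from Comp.IH(2) obtain N2 where N2: "\<And>M gs. M \<ge> N2 \<Longrightarrow> agree M fs gs \<Longrightarrow> computes gs c vs w"
    by blast
  have "computes gs (recfn.Comp c ds) ns w" if "M \<ge> max N1 N2" "agree M fs gs" for M gs
    using that len by (intro computes.Comp[of gs ns ds vs] list_all2_all_nthI) (auto intro: N1 N2)
  then show ?case by blast
next
  case (PrimRec_0 c ns v d)
  then show ?case by (meson computes.PrimRec_0)
next
  case (PrimRec_Suc c d n ns v w)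
  then obtain N1 N2 where
      "\<forall>M\<ge>N1. \<forall>gs. agree M fs gs \<longrightarrow> computes gs (PrimRec c d) (n # ns) v"
      "\<forall>M\<ge>N2. \<forall>gs. agree M fs gs \<longrightarrow> computes gs d (n # v # ns) w" by blast
  then have "\<forall>M\<ge>max N1 N2. \<forall>gs. agree M fs gs \<longrightarrow> computes gs (PrimRec c d) (Suc n # ns) w"
    by (meson computes.PrimRec_Suc max.bounded_iff)
  then show ?case by blast
next
  case (Mu c n ns)
  from Mu.IH(1) obtain N1 where
    N1: "\<And>M gs. M \<ge> N1 \<Longrightarrow> agree M fs gs \<Longrightarrow> computes gs c (n # ns) 0" by blast
  \<comment> \<open>The value \<open>v\<close> may depend on \<open>gs\<close> here: minimisation
    needs only that the values before \<open>n\<close> exist and are positive.\<close>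
  have "\<exists>N. \<forall>M\<ge>N. \<forall>j<n. \<forall>gs. agree M fs gs \<longrightarrow> (\<exists>v. computes gs c (j # ns) v \<and> v > 0)"
    using Mu.IH(2) by (intro uniform_bound_nat) meson
  then obtain N2 where N2: "\<And>M gs j. M \<ge> N2 \<Longrightarrow> j < n \<Longrightarrow> agree M fs gs \<Longrightarrow>
      \<exists>v. computes gs c (j # ns) v \<and> v > 0" by blast
  have "computes gs (recfn.Mu c) ns n" if "M \<ge> max N1 N2" "agree M fs gs" for M gs
    using that by (intro computes.Mu) (auto intro: N1 N2)
  then show ?case by blast
qed

text \<open>The first \<open>N\<close> values of the finitely many output functions, and the output
  numbers, come from finitely many computations, so a common use bound exists. Number arguments are
  discrete, hence \<open>ns\<close> stays fixed and \<open>ms\<close> is locally constant.\<close>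

lemma computable_functional_continuous:
  assumes "computable_functional F" and "F (fs, ns) = Some (gs, ms)"
  shows "\<exists>M. \<forall>fs' gs' ms'. agree M fs fs' \<longrightarrow> F (fs', ns) = Some (gs', ms') \<longrightarrow>
    agree N gs gs' \<and> ms' = ms"
proof -
  from assms(1) obtain cs ds where
    prog: "\<And>fs ns gs ms. F (fs, ns) = Some (gs, ms) \<Longrightarrow>
      list_all2 (\<lambda>c g. \<forall>j. computes fs c (j # ns) (g j)) cs gs \<and>
      list_all2 (\<lambda>d m. computes fs d ns m) ds ms"
    unfolding computable_functional_def by blast
  note p = prog[OF assms(2), unfolded list_all2_conv_all_nth]
  have "\<exists>M. \<forall>M'\<ge>M. \<forall>i<length cs. \<forall>j<N. \<forall>fs'. agree M' fs fs' \<longrightarrow>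
      computes fs' (cs ! i) (j # ns) ((gs ! i) j)"
    using p by (intro uniform_bound_nat computes_finite_use) auto
  then obtain M1 where M1: "\<And>i j M fs'. M \<ge> M1 \<Longrightarrow> i < length cs \<Longrightarrow> j < N \<Longrightarrow> agree M fs fs' \<Longrightarrow>
      computes fs' (cs ! i) (j # ns) ((gs ! i) j)" by blast
  have "\<exists>M. \<forall>M'\<ge>M. \<forall>i<length ds. \<forall>fs'. agree M' fs fs' \<longrightarrow> computes fs' (ds ! i) ns (ms ! i)"
    using p by (intro uniform_bound_nat computes_finite_use) auto
  then obtain M2 where M2: "\<And>i M fs'. M \<ge> M2 \<Longrightarrow> i < length ds \<Longrightarrow> agree M fs fs' \<Longrightarrow>
      computes fs' (ds ! i) ns (ms ! i)" by blast
  have "agree N gs gs' \<and> ms' = ms"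
    if ag: "agree (max M1 M2) fs fs'" and F: "F (fs', ns) = Some (gs', ms')" for fs' gs' ms'
  proof
    \<comment> \<open>On \<open>fs'\<close> the same programs yield both the outputs carried over
      from \<open>fs\<close> and the outputs of \<open>F\<close> there; determinism identifies
      them.\<close>
    note p' = prog[OF F, unfolded list_all2_conv_all_nth]
    show "agree N gs gs'"
      unfolding agree_def
    proof (rule list_all2_all_nthI)
      show "length gs = length gs'" using p p' by simp
      show "\<forall>k<N. (gs ! i) k = (gs' ! i) k" if "i < length gs" for i
        using that p p' M1[OF max.cobounded1 _ _ ag] computes_deterministic by metis
    qed
    show "ms' = ms"
      using p p' M2[OF max.cobounded2 _ ag] computes_deterministic
      by (metis nth_equalityI)
  qed
  then show ?thesis by blast
qed

subsection \<open>Step functions and their parities\<close>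

lemma less_fun_iff_at_first_difference:
  fixes x y :: "nat \<Rightarrow> nat"
  assumes "x k \<noteq> y k" and "\<And>j. j < k \<Longrightarrow> x j = y j"
  shows "less_fun x y \<longleftrightarrow> x k < y k"
proof
  assume "less_fun x y"
  then obtain l where "x l < y l" "\<And>j. j < l \<Longrightarrow> x j = y j" by (auto elim: less_funE)
  then show "x k < y k" using assms by (metis less_irrefl linorder_neqE_nat)
qed (use assms in \<open>auto intro: less_funI\<close>)

lemma step_self: "step \<alpha> \<alpha> = 1"
  by (simp add: step_def less_fun_irrefl)

text \<open>The first difference from \<open>\<alpha>\<close> decides the comparison, and every
  \<open>y\<close> agreeing with \<open>x\<close> beyond that position has the same first
  difference.\<close>

lemma step_locally_constant:
  assumes "x \<noteq> \<alpha>"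
  shows "\<exists>N. \<forall>M\<ge>N. \<forall>y. (\<forall>k<M. x k = y k) \<longrightarrow> y \<noteq> \<alpha> \<and> step \<alpha> y = step \<alpha> x"
proof -
  define k where "k = (LEAST k. x k \<noteq> \<alpha> k)"
  from assms have "\<exists>k. x k \<noteq> \<alpha> k" by blast
  then have k: "x k \<noteq> \<alpha> k" unfolding k_def by (rule LeastI_ex)
  have less: "x j = \<alpha> j" if "j < k" for j
    using that not_less_Least unfolding k_def by blast
  have "y \<noteq> \<alpha> \<and> step \<alpha> y = step \<alpha> x" if "M \<ge> Suc k" "\<forall>k<M. x k = y k" for M y
  proof -
    have y: "y k = x k" "\<And>j. j < k \<Longrightarrow> y j = \<alpha> j" using that less by auto
    have "less_fun x \<alpha> \<longleftrightarrow> x k < \<alpha> k"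
      using k less by (rule less_fun_iff_at_first_difference)
    moreover have "less_fun y \<alpha> \<longleftrightarrow> y k < \<alpha> k"
      by (rule less_fun_iff_at_first_difference) (use k y in simp_all)
    ultimately show ?thesis using k y(1) by (metis step_def)
  qed
  then show ?thesis by blast
qed

text \<open>Properness supplies a 1 of \<open>\<alpha>\<close> at some position from
  \<open>N\<close> on; changing it to 0 gives the witness.\<close>

lemma proper_approx_below:
  assumes "\<alpha> \<in> cantor" and "proper \<alpha>"
  shows "\<exists>x\<in>cantor. (\<forall>k<N. \<alpha> k = x k) \<and> x \<noteq> \<alpha> \<and> step \<alpha> x = 0"
proof -
  from assms(2) obtain m where m: "m \<ge> N" "\<alpha> m = 1"
    unfolding proper_def infinite_nat_iff_unbounded_le by auto
  let ?x = "\<alpha>(m := 0)"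
  have "less_fun ?x \<alpha>" using m by (auto intro: less_funI)
  then have "step \<alpha> ?x = 0" by (simp add: step_def)
  moreover have "?x \<in> cantor" using assms(1) by (auto simp: cantor_def)
  moreover have "\<forall>k<N. \<alpha> k = ?x k" using m by auto
  ultimately show ?thesis using step_self by (metis zero_neq_one)
qed

definition parity :: "(nat \<Rightarrow> nat) list \<Rightarrow> (nat \<Rightarrow> nat) list \<Rightarrow> nat" where
  "parity \<alpha>s xs = (\<Sum>i<length \<alpha>s. step (\<alpha>s ! i) (xs ! i)) mod 2"

definition hits :: "(nat \<Rightarrow> nat) list \<Rightarrow> (nat \<Rightarrow> nat) list \<Rightarrow> nat set" where
  "hits \<alpha>s xs = {i. i < length \<alpha>s \<and> xs ! i = \<alpha>s ! i}"

lemma finite_hits [simp]: "finite (hits \<alpha>s xs)"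
  by (simp add: hits_def)

lemma step_xor_Some_iff:
  "step_xor \<alpha>s x = Some y \<longleftrightarrow>
    (\<exists>xs. x = (xs, []) \<and> length xs = length \<alpha>s \<and> set xs \<subseteq> cantor \<and> y = ([], [parity \<alpha>s xs]))"
  by (cases x) (auto simp: step_xor_def parity_def)

text \<open>Close to \<open>zs\<close>, unequal coordinates stay unequal, so the set of hits can
  only shrink. The cardinality condition excludes shrinking, so coordinates that hit are unchanged
  and all others have locally constant steps.\<close>

lemma parity_locally_constant:
  assumes "length zs = length \<alpha>s"
  shows "\<exists>N. \<forall>zs'. agree N zs zs' \<and> card (hits \<alpha>s zs) \<le> card (hits \<alpha>s zs') \<longrightarrow>
    parity \<alpha>s zs' = parity \<alpha>s zs"
proof -
  have "\<exists>N. \<forall>M\<ge>N. \<forall>i<length \<alpha>s. zs ! i \<noteq> \<alpha>s ! i \<longrightarrow> (\<forall>y. (\<forall>k<M. (zs ! i) k = y k) \<longrightarrow>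
      y \<noteq> \<alpha>s ! i \<and> step (\<alpha>s ! i) y = step (\<alpha>s ! i) (zs ! i))"
  proof (rule uniform_bound_nat)
    fix i
    show "\<exists>N. \<forall>M\<ge>N. zs ! i \<noteq> \<alpha>s ! i \<longrightarrow> (\<forall>y. (\<forall>k<M. (zs ! i) k = y k) \<longrightarrow>
        y \<noteq> \<alpha>s ! i \<and> step (\<alpha>s ! i) y = step (\<alpha>s ! i) (zs ! i))"
      by (cases "zs ! i = \<alpha>s ! i") (simp_all add: step_locally_constant)
  qed
  then obtain N where N: "\<And>i y. i < length \<alpha>s \<Longrightarrow> zs ! i \<noteq> \<alpha>s ! i \<Longrightarrow>
      \<forall>k<N. (zs ! i) k = y k \<Longrightarrow> y \<noteq> \<alpha>s ! i \<and> step (\<alpha>s ! i) y = step (\<alpha>s ! i) (zs ! i)"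
    by (metis order_refl)
  have "parity \<alpha>s zs' = parity \<alpha>s zs"
    if ag: "agree N zs zs'" and card: "card (hits \<alpha>s zs) \<le> card (hits \<alpha>s zs')" for zs'
  proof -
    have near: "\<forall>k<N. (zs ! i) k = (zs' ! i) k" if "i < length \<alpha>s" for i
      using ag that assms by (simp add: agree_def list_all2_conv_all_nth)
    have "hits \<alpha>s zs' \<subseteq> hits \<alpha>s zs"
      using N near by (fastforce simp: hits_def)
    then have eq: "hits \<alpha>s zs' = hits \<alpha>s zs"
      using card by (intro card_seteq) auto
    have "step (\<alpha>s ! i) (zs' ! i) = step (\<alpha>s ! i) (zs ! i)" if "i < length \<alpha>s" for i
    proof (cases "zs ! i = \<alpha>s ! i")
      case True
      then have "i \<in> hits \<alpha>s zs'" using that eq by (simp add: hits_def)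
      then show ?thesis using True by (simp add: hits_def)
    qed (use that N near in blast)
    then show ?thesis by (simp add: parity_def)
  qed
  then show ?thesis by blast
qed

lemma parity_discontinuous:
  assumes "length xs = length \<alpha>s" and "set xs \<subseteq> cantor" and "i \<in> hits \<alpha>s xs"
    and "\<alpha>s ! i \<in> cantor" and "proper (\<alpha>s ! i)"
  shows "\<exists>xs'. length xs' = length \<alpha>s \<and> set xs' \<subseteq> cantor \<and> agree N xs xs' \<and>
    hits \<alpha>s xs' = hits \<alpha>s xs - {i} \<and> parity \<alpha>s xs' \<noteq> parity \<alpha>s xs"
proof -
  have i: "i < length \<alpha>s" "xs ! i = \<alpha>s ! i" using assms(3) by (auto simp: hits_def)
  from proper_approx_below[OF assms(4,5)] obtain x where
    x: "x \<in> cantor" "\<forall>k<N. (\<alpha>s ! i) k = x k" "x \<noteq> \<alpha>s ! i" "step (\<alpha>s ! i) x = 0" by blast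
  let ?xs' = "xs[i := x]"
  have "hits \<alpha>s ?xs' = hits \<alpha>s xs - {i}"
    using i x assms(1) by (auto simp: hits_def nth_list_update)
  moreover have "parity \<alpha>s ?xs' \<noteq> parity \<alpha>s xs"
  proof -
    \<comment> \<open>Summand \<open>i\<close> is split off: it is 1 at \<open>xs\<close> by
      \<open>step_self\<close> and 0 at \<open>?xs'\<close>, so the two sums differ by exactly
      one.\<close>
    let ?S = "\<Sum>j\<in>{..<length \<alpha>s} - {i}. step (\<alpha>s ! j) (xs ! j)"
    have "(\<Sum>j\<in>{..<length \<alpha>s} - {i}. step (\<alpha>s ! j) (?xs' ! j)) = ?S"
      by (intro sum.cong) auto
    then have "parity \<alpha>s ?xs' = ?S mod 2" "parity \<alpha>s xs = Suc ?S mod 2"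
      using i x assms(1) by (auto simp: parity_def sum.remove[of "{..<length \<alpha>s}" i] step_self)
    then show ?thesis by presburger
  qed
  moreover have "agree N xs ?xs'" using i x assms(1) by (intro agree_list_update) auto
  moreover have "set ?xs' \<subseteq> cantor"
    using assms(2) x(1) set_update_subset_insert by fastforce
  ultimately show ?thesis using assms(1) by (intro exI[of _ ?xs']) simp
qed

subsection \<open>Comparing parities\<close>

lemma not_weihrauch_le_step_xor:
  assumes proper: "\<And>\<beta>. \<beta> \<in> set \<beta>s \<Longrightarrow> \<beta> \<in> cantor \<and> proper \<beta>"
    and shorter: "length \<alpha>s < length \<beta>s"
  shows "\<not> step_xor \<beta>s \<le>\<^sub>W step_xor \<alpha>s"
proof
  assume "step_xor \<beta>s \<le>\<^sub>W step_xor \<alpha>s"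
  then obtain \<Phi> \<Psi> where comp: "computable_functional \<Phi>" "computable_functional \<Psi>"
    and red: "\<And>x y. step_xor \<beta>s x = Some y \<Longrightarrow>
      \<exists>z w. \<Phi> x = Some z \<and> step_xor \<alpha>s z = Some w \<and> \<Psi> (point_pair x w) = Some y"
    unfolding weihrauch_le_def by blast
  let ?dom = "\<lambda>xs. length xs = length \<beta>s \<and> set xs \<subseteq> cantor"
  \<comment> \<open>The only information about \<open>zs\<close> that reaches \<open>\<Psi>\<close>
    is one bit; wherever that bit is constant, the answer depends continuously on \<open>xs\<close>
    alone.\<close>
  have red': "\<exists>zs. \<Phi> (xs, []) = Some (zs, []) \<and> length zs = length \<alpha>s \<and>
      \<Psi> (xs, [parity \<alpha>s zs]) = Some ([], [parity \<beta>s xs])" if "?dom xs" for xs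
  proof -
    have "step_xor \<beta>s (xs, []) = Some ([], [parity \<beta>s xs])"
      using that by (simp add: step_xor_Some_iff)
    from red[OF this] show ?thesis by (auto simp: step_xor_Some_iff point_pair_def)
  qed
  \<comment> \<open>The claim is general in \<open>xs\<close> because the induction hypothesis is
    applied to a nearby tuple with one hit fewer.\<close>
  have hits_le: "k \<le> card (hits \<alpha>s zs)"
    if "?dom xs" "k \<le> card (hits \<beta>s xs)" "\<Phi> (xs, []) = Some (zs, [])" for k xs zs
    using that
  proof (induction k arbitrary: xs zs)
    case 0
    then show ?case by simp
  next
    case (Suc k)
    from red'[OF Suc.prems(1)] Suc.prems(3) have zs: "length zs = length \<alpha>s"
      "\<Psi> (xs, [parity \<alpha>s zs]) = Some ([], [parity \<beta>s xs])" by auto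
    show ?case
    proof (rule ccontr)
      assume "\<not> Suc k \<le> card (hits \<alpha>s zs)"
      then have few: "card (hits \<alpha>s zs) \<le> k" by simp
      from parity_locally_constant[OF zs(1)] obtain N where
        N: "\<And>zs'. agree N zs zs' \<Longrightarrow> card (hits \<alpha>s zs) \<le> card (hits \<alpha>s zs') \<Longrightarrow>
          parity \<alpha>s zs' = parity \<alpha>s zs" by blast
      from computable_functional_continuous[OF comp(1) Suc.prems(3), of N] obtain M1 where
        M1: "\<And>xs' zs'. agree M1 xs xs' \<Longrightarrow> \<Phi> (xs', []) = Some (zs', []) \<Longrightarrow> agree N zs zs'"
        by blast
      \<comment> \<open>Continuity of \<open>\<Psi>\<close> is taken with the bit at
        \<open>zs\<close> held fixed; it applies to \<open>xs'\<close> once \<open>zs'\<close> is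
        known to give the same bit.\<close>
      from computable_functional_continuous[OF comp(2) zs(2)] obtain M2 where
        M2: "\<And>xs' ys ms. agree M2 xs xs' \<Longrightarrow> \<Psi> (xs', [parity \<alpha>s zs]) = Some (ys, ms) \<Longrightarrow>
          ms = [parity \<beta>s xs]" by blast
      from Suc.prems(2) obtain i where i: "i \<in> hits \<beta>s xs"
        by (metis card.empty all_not_in_conv not_less_eq_eq zero_le)
      then have "\<beta>s ! i \<in> set \<beta>s" by (simp add: hits_def)
      with parity_discontinuous[of xs \<beta>s i "max M1 M2"] Suc.prems(1) i proper
      obtain xs' where xs': "?dom xs'" "agree (max M1 M2) xs xs'"
        "hits \<beta>s xs' = hits \<beta>s xs - {i}" "parity \<beta>s xs' \<noteq> parity \<beta>s xs" by blast
      from red'[OF xs'(1)] obtain zs' where zs': "\<Phi> (xs', []) = Some (zs', [])"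
        "\<Psi> (xs', [parity \<alpha>s zs']) = Some ([], [parity \<beta>s xs'])" by blast
      \<comment> \<open>Exactly one hit was lost, so the induction hypothesis still yields
        \<open>k\<close> hits for \<open>zs'\<close>. Since \<open>zs\<close> has at most
        \<open>k\<close>, the condition for local constancy of the parity is met.\<close>
      have "k \<le> card (hits \<beta>s xs')" using xs'(3) i Suc.prems(2) by simp
      then have "k \<le> card (hits \<alpha>s zs')" using Suc.IH xs'(1) zs'(1) by blast
      moreover have "agree N zs zs'"
        by (rule M1[OF agree_mono[OF xs'(2) max.cobounded1] zs'(1)])
      ultimately have "parity \<alpha>s zs' = parity \<alpha>s zs"
        using few N by simp
      then have "parity \<beta>s xs' = parity \<beta>s xs"
        using M2[of xs'] zs'(2) agree_mono[OF xs'(2)] by fastforce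
      with xs'(4) show False by contradiction
    qed
  qed
  \<comment> \<open>The tuple \<open>\<beta>s\<close> itself hits in every coordinate, more often
    than the coordinates of \<open>zs\<close> allow.\<close>
  have dom: "?dom \<beta>s" using proper by blast
  then obtain zs where "\<Phi> (\<beta>s, []) = Some (zs, [])" using red' by blast
  with hits_le[OF dom order_refl] have "card (hits \<beta>s \<beta>s) \<le> card (hits \<alpha>s zs)" by blast
  also have "\<dots> \<le> card {..<length \<alpha>s}" by (rule card_mono) (auto simp: hits_def)
  finally show False using shorter by (simp add: hits_def)
qed

text \<open>The zero sequence lies strictly below \<open>\<alpha>\<close>, so appending it adds 0 to
  the sum, and the answer bit can be returned unchanged.\<close>

lemma strong_weihrauch_le_step_xor_snoc:
  assumes "proper \<alpha>"
  shows "step_xor \<alpha>s \<le>\<^sub>s\<^sub>W step_xor (\<alpha>s @ [\<alpha>])"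
proof -
  let ?zero = "\<lambda>_::nat. 0::nat"
  \<comment> \<open>The guards here and in \<open>\<Psi>\<close> confine each domain to a single
    product space, as \<open>computable_functional\<close> demands.\<close>
  define \<Phi> :: "point \<rightharpoonup> point" where "\<Phi> = (\<lambda>(xs, ns).
    if length xs = length \<alpha>s \<and> ns = [] then Some (xs @ [?zero], []) else None)"
  define \<Psi> :: "point \<rightharpoonup> point" where "\<Psi> = (\<lambda>(xs, ns).
    if length ns = 1 \<and> xs = [] then Some (xs, ns) else None)"
  have "step \<alpha> ?zero = 0"
  proof -
    from assms have "\<exists>m. \<alpha> m \<noteq> 0"
      unfolding proper_def infinite_nat_iff_unbounded_le by (metis mem_Collect_eq zero_neq_one)
    then obtain m where "\<alpha> m \<noteq> 0" "\<And>j. j < m \<Longrightarrow> \<alpha> j = 0"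
      using exists_least_iff[of "\<lambda>m. \<alpha> m \<noteq> 0"] by auto
    then have "less_fun ?zero \<alpha>" by (intro less_funI exI[of _ m]) simp
    then show ?thesis by (simp add: step_def)
  qed
  then have parity: "parity (\<alpha>s @ [\<alpha>]) (xs @ [?zero]) = parity \<alpha>s xs"
    if "length xs = length \<alpha>s" for xs
    using that by (simp add: parity_def nth_append)
  \<comment> \<open>\<open>Query i\<close> copies the \<open>i\<close>-th argument, and
    \<open>Zero\<close> produces the appended sequence.\<close>
  have "computable_functional \<Phi>"
    unfolding computable_functional_def
    by (rule exI[of _ "length \<alpha>s"], rule exI[of _ 0],
        rule exI[of _ "map Query [0..<length \<alpha>s] @ [Zero]"], rule exI[of _ "[]"])
      (auto simp: \<Phi>_def list_all2_conv_all_nth nth_append less_Suc_eq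
        intro: computes.intros split: if_splits)
  moreover have "computable_functional \<Psi>"
    unfolding computable_functional_def
    by (rule exI[of _ 0], rule exI[of _ 1], rule exI[of _ "[]"], rule exI[of _ "[Proj 0]"])
      (auto simp: \<Psi>_def list_all2_conv_all_nth intro: computes.intros split: if_splits)
  moreover have "\<exists>z w. \<Phi> x = Some z \<and> step_xor (\<alpha>s @ [\<alpha>]) z = Some w \<and> \<Psi> w = Some y"
    if xy: "step_xor \<alpha>s x = Some y" for x y
  proof -
    from xy obtain xs where xs: "x = (xs, [])" "length xs = length \<alpha>s" "set xs \<subseteq> cantor"
      "y = ([], [parity \<alpha>s xs])" by (auto simp: step_xor_Some_iff)
    then have "step_xor (\<alpha>s @ [\<alpha>]) (xs @ [?zero], []) = Some y"
      by (simp add: step_xor_Some_iff parity cantor_def)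
    with xs show ?thesis by (simp add: \<Phi>_def \<Psi>_def)
  qed
  ultimately show ?thesis unfolding strong_weihrauch_le_def by blast
qed

theorem mainTheorem2:
  fixes n :: nat and \<alpha>s :: "(nat \<Rightarrow> nat) list"
  assumes "n > 0"
    and "length \<alpha>s = n + 1"
    and "\<And>\<alpha>. \<alpha> \<in> set \<alpha>s \<Longrightarrow> \<alpha> \<in> cantor \<and> proper \<alpha>"
  shows "step_xor (take n \<alpha>s) \<le>\<^sub>s\<^sub>W step_xor \<alpha>s \<and> \<not> step_xor \<alpha>s \<le>\<^sub>W step_xor (take n \<alpha>s)"
proof
  have split: "\<alpha>s = take n \<alpha>s @ [\<alpha>s ! n]"
    using assms(2) by (metis Suc_eq_plus1 lessI order_refl take_Suc_conv_app_nth take_all)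
  have "proper (\<alpha>s ! n)" using assms(2,3) by simp
  \<comment> \<open>Only the right-hand \<open>\<alpha>s\<close> is split; the occurrence inside
    \<open>take n \<alpha>s\<close> must stay.\<close>
  then show "step_xor (take n \<alpha>s) \<le>\<^sub>s\<^sub>W step_xor \<alpha>s"
    by (subst (2) split) (rule strong_weihrauch_le_step_xor_snoc)
  show "\<not> step_xor \<alpha>s \<le>\<^sub>W step_xor (take n \<alpha>s)"
    using assms(2,3) by (intro not_weihrauch_le_step_xor) auto
qed

end
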